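(* For any finite category $\mathbf{A}$, the formal power series $f_{\mathbf{A}}(t) = \sum_{n \ge 0} c_n t^n \in \mathbb{Q}[[t]]$, where $c_n$ is the number of nondegenerate $n$-simplices of the nerve $N\mathbf{A}$, is rational over $\mathbb{Q}$.
   Context: A finite category is a category with finitely many objects and finitely many arrows. The nerve $N\mathbf{A}$ of a category $\mathbf{A}$ is the simplicial set in which an $n$-simplex is a chain $x_0 \xrightarrow{\phi_1} x_1 \xrightarrow{\phi_2} \cdots \xrightarrow{\phi_n} x_n$ of arrows in $\mathbf{A}$ (for $n=0$, an object $x_0$); such an $n$-simplex is degenerate if and only if some $\phi_i$ is an identity. So $c_n$ is the number of chains of $n$ composable non-identity arrows in $\mathbf{A}$ (with $c_0$ the number of objects). For a field $K$, a formal power series $f \in K[[t]]$ is called rational (over $K$) if its image in the field of formal Laurent series $K((t))$ lies in the image of the canonical inclusion $K(t) \hookrightarrow K((t))$, where $K(t)$ is the field of rational expressions over $K$. *)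

theory Defs
  imports "HOL-Computational_Algebra.Computational_Algebra"
begin

section \<open>Finite categories\<close>

record ('o, 'm) cat =
  Obj :: "'o set"
  Arr :: "'m set"
  Src :: "'m \<Rightarrow> 'o"
  Trg :: "'m \<Rightarrow> 'o"
  Idn :: "'o \<Rightarrow> 'm"
  Cmp :: "'m \<Rightarrow> 'm \<Rightarrow> 'm"

text \<open>\<open>Cmp A g f\<close> is \<open>g\<close> after \<open>f\<close>; the operations are only constrained on the carriers
  \<open>Obj A\<close> and \<open>Arr A\<close>, and \<open>Cmp A\<close> only on composable pairs.\<close>

locale category =
  fixes A :: "('o, 'm) cat"
  assumes Src_in [simp]: "f \<in> Arr A \<Longrightarrow> Src A f \<in> Obj A"
    and Trg_in [simp]: "f \<in> Arr A \<Longrightarrow> Trg A f \<in> Obj A"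
    and Idn_in [simp]: "x \<in> Obj A \<Longrightarrow> Idn A x \<in> Arr A"
    and Src_Idn [simp]: "x \<in> Obj A \<Longrightarrow> Src A (Idn A x) = x"
    and Trg_Idn [simp]: "x \<in> Obj A \<Longrightarrow> Trg A (Idn A x) = x"
    and Cmp_in [simp]: "\<lbrakk>f \<in> Arr A; g \<in> Arr A; Trg A f = Src A g\<rbrakk> \<Longrightarrow> Cmp A g f \<in> Arr A"
    and Src_Cmp [simp]: "\<lbrakk>f \<in> Arr A; g \<in> Arr A; Trg A f = Src A g\<rbrakk> \<Longrightarrow> Src A (Cmp A g f) = Src A f"
    and Trg_Cmp [simp]: "\<lbrakk>f \<in> Arr A; g \<in> Arr A; Trg A f = Src A g\<rbrakk> \<Longrightarrow> Trg A (Cmp A g f) = Trg A g"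
    and Cmp_Idn_right [simp]: "f \<in> Arr A \<Longrightarrow> Cmp A f (Idn A (Src A f)) = f"
    and Cmp_Idn_left [simp]: "f \<in> Arr A \<Longrightarrow> Cmp A (Idn A (Trg A f)) f = f"
    and Cmp_assoc: "\<lbrakk>f \<in> Arr A; g \<in> Arr A; h \<in> Arr A; Trg A f = Src A g; Trg A g = Src A h\<rbrakk>
      \<Longrightarrow> Cmp A h (Cmp A g f) = Cmp A (Cmp A h g) f"

locale finite_category = category +
  assumes finite_Obj: "finite (Obj A)"
    and finite_Arr: "finite (Arr A)"


section \<open>Simplicial sets and nondegenerate simplices\<close>

record 's sset =
  Simp :: "nat \<Rightarrow> 's set"
  Face :: "nat \<Rightarrow> 's \<Rightarrow> 's"
  Degen :: "nat \<Rightarrow> 's \<Rightarrow> 's"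

text \<open>The dimension is not an argument of \<open>Face\<close> and \<open>Degen\<close>; it is determined by the simplices
  to which they are applied.\<close>

locale simplicial_set =
  fixes X :: "'s sset"
  assumes Face_in: "\<lbrakk>x \<in> Simp X (Suc n); i \<le> Suc n\<rbrakk> \<Longrightarrow> Face X i x \<in> Simp X n"
    and Degen_in: "\<lbrakk>x \<in> Simp X n; i \<le> n\<rbrakk> \<Longrightarrow> Degen X i x \<in> Simp X (Suc n)"
    and Face_Face: "\<lbrakk>x \<in> Simp X (Suc (Suc n)); i < j; j \<le> Suc (Suc n)\<rbrakk>
      \<Longrightarrow> Face X i (Face X j x) = Face X (j - 1) (Face X i x)"
    and Face_Degen_less: "\<lbrakk>x \<in> Simp X n; i < j; j \<le> n\<rbrakk>
      \<Longrightarrow> Face X i (Degen X j x) = Degen X (j - 1) (Face X i x)"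
    and Face_Degen_same: "\<lbrakk>x \<in> Simp X n; j \<le> n\<rbrakk> \<Longrightarrow> Face X j (Degen X j x) = x"
    and Face_Degen_Suc: "\<lbrakk>x \<in> Simp X n; j \<le> n\<rbrakk> \<Longrightarrow> Face X (Suc j) (Degen X j x) = x"
    and Face_Degen_greater: "\<lbrakk>x \<in> Simp X n; Suc j < i; i \<le> Suc n\<rbrakk>
      \<Longrightarrow> Face X i (Degen X j x) = Degen X j (Face X (i - 1) x)"
    and Degen_Degen: "\<lbrakk>x \<in> Simp X n; i \<le> j; j \<le> n\<rbrakk>
      \<Longrightarrow> Degen X i (Degen X j x) = Degen X (Suc j) (Degen X i x)"

definition degenerate :: "'s sset \<Rightarrow> nat \<Rightarrow> 's \<Rightarrow> bool" where
  "degenerate X n x \<longleftrightarrow> (\<exists>m i. \<exists>y \<in> Simp X m. n = Suc m \<and> i \<le> m \<and> x = Degen X i y)"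

definition nondegenerate_simplices :: "'s sset \<Rightarrow> nat \<Rightarrow> 's set" where
  "nondegenerate_simplices X n = {x \<in> Simp X n. \<not> degenerate X n x}"


section \<open>The nerve of a category\<close>

text \<open>A pair \<open>(x, [\<phi>\<^sub>1, \<dots>, \<phi>\<^sub>n])\<close> encodes the chain starting at the object \<open>x\<close> whose \<open>k\<close>-th arrow
  is \<open>\<phi>\<^sub>k\<close>; recording \<open>x\<close> matters for \<open>n = 0\<close> only. List indices start at 0, so that
  \<open>fs ! k\<close> goes from vertex \<open>k\<close> to vertex \<open>k + 1\<close>.\<close>

fun chain_vertex :: "('o, 'm) cat \<Rightarrow> 'o \<times> 'm list \<Rightarrow> nat \<Rightarrow> 'o" where
  "chain_vertex A (x, fs) 0 = x"
| "chain_vertex A (x, fs) (Suc k) = Trg A (fs ! k)"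

definition composable_chains :: "('o, 'm) cat \<Rightarrow> nat \<Rightarrow> ('o \<times> 'm list) set" where
  "composable_chains A n = {(x, fs). x \<in> Obj A \<and> set fs \<subseteq> Arr A \<and> length fs = n \<and>
     (\<forall>k<n. Src A (fs ! k) = chain_vertex A (x, fs) k)}"

text \<open>The \<open>i\<close>-th face omits vertex \<open>i\<close>: an inner face composes the two arrows meeting there, the
  two outer faces drop the first and the last arrow.\<close>

fun chain_face :: "('o, 'm) cat \<Rightarrow> nat \<Rightarrow> 'o \<times> 'm list \<Rightarrow> 'o \<times> 'm list" where
  "chain_face A i (x, fs) =
     (if i = 0 then chain_vertex A (x, fs) 1 else x,
      map (\<lambda>k. if Suc k < i then fs ! k
               else if Suc k = i then Cmp A (fs ! Suc k) (fs ! k)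
               else fs ! Suc k)
        [0..<length fs - 1])"

text \<open>The \<open>i\<close>-th degeneracy repeats vertex \<open>i\<close> by inserting its identity.\<close>

fun chain_degen :: "('o, 'm) cat \<Rightarrow> nat \<Rightarrow> 'o \<times> 'm list \<Rightarrow> 'o \<times> 'm list" where
  "chain_degen A i (x, fs) =
     (x, take i fs @ Idn A (chain_vertex A (x, fs) i) # drop i fs)"

definition nerve :: "('o, 'm) cat \<Rightarrow> ('o \<times> 'm list) sset" where
  "nerve A = \<lparr>Simp = composable_chains A, Face = chain_face A, Degen = chain_degen A\<rparr>"

lemma fst_eq_chain_vertex: "fst s = chain_vertex A s 0"
  by (cases s) simp

lemma Trg_chain: "Trg A (snd s ! k) = chain_vertex A s (Suc k)"
  by (cases s) simp

lemma length_chain: "s \<in> composable_chains A n \<Longrightarrow> length (snd s) = n"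
  by (auto simp: composable_chains_def)

lemma Arr_chain: "s \<in> composable_chains A n \<Longrightarrow> k < n \<Longrightarrow> snd s ! k \<in> Arr A"
  by (auto simp: composable_chains_def subset_eq)

lemma Src_chain: "s \<in> composable_chains A n \<Longrightarrow> k < n \<Longrightarrow> Src A (snd s ! k) = chain_vertex A s k"
  by (auto simp: composable_chains_def)

lemma composable_chainsI:
  assumes "fst s \<in> Obj A" "length (snd s) = n"
    and "\<And>k. k < n \<Longrightarrow> snd s ! k \<in> Arr A"
    and "\<And>k. k < n \<Longrightarrow> Src A (snd s ! k) = chain_vertex A s k"
  shows "s \<in> composable_chains A n"
  using assms by (cases s) (auto simp: composable_chains_def in_set_conv_nth)

lemma chain_eqI:
  assumes "s \<in> composable_chains A n" "t \<in> composable_chains A n"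
    and "chain_vertex A s 0 = chain_vertex A t 0"
    and "\<And>k. k < n \<Longrightarrow> snd s ! k = snd t ! k"
  shows "s = t"
  using assms by (metis fst_eq_chain_vertex length_chain nth_equalityI prod.expand)

lemma nth_chain_face:
  assumes "length (snd s) = Suc n" "k < n"
  shows "snd (chain_face A i s) ! k =
    (if Suc k < i then snd s ! k
     else if Suc k = i then Cmp A (snd s ! Suc k) (snd s ! k)
     else snd s ! Suc k)"
  using assms by (cases s) simp

lemma nth_chain_degen:
  assumes "length (snd s) = n" "i \<le> n" "k \<le> n"
  shows "snd (chain_degen A i s) ! k =
    (if k < i then snd s ! k else if k = i then Idn A (chain_vertex A s i) else snd s ! (k - 1))"
  using assms by (cases s) (auto simp: nth_append nth_Cons')

lemma length_chain_face: "length (snd (chain_face A i s)) = length (snd s) - 1"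
  by (cases s) simp

lemma length_chain_degen: "i \<le> length (snd s) \<Longrightarrow> length (snd (chain_degen A i s)) = Suc (length (snd s))"
  by (cases s) simp

context category
begin

lemma chain_vertex_in:
  assumes "s \<in> composable_chains A n" "k \<le> n"
  shows "chain_vertex A s k \<in> Obj A"
  using assms by (cases s; cases k) (auto simp: composable_chains_def subset_eq)

lemma chain_vertex_face:
  assumes "s \<in> composable_chains A (Suc n)" "i \<le> Suc n" "k \<le> n"
  shows "chain_vertex A (chain_face A i s) k = chain_vertex A s (if k < i then k else Suc k)"
proof (cases k)
  case 0
  then show ?thesis by (cases s) simp
next
  case (Suc l)
  with assms(3) have l: "l < n" by simp
  have "chain_vertex A (chain_face A i s) k = Trg A (snd (chain_face A i s) ! l)"
    by (simp add: Suc Trg_chain)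
  also have "\<dots> = chain_vertex A s (if k < i then k else Suc k)"
    unfolding nth_chain_face[OF length_chain[OF assms(1)] l]
    using assms l Suc by (auto simp: Arr_chain Src_chain Trg_chain)
  finally show ?thesis .
qed

lemma chain_vertex_degen:
  assumes "s \<in> composable_chains A n" "i \<le> n" "k \<le> Suc n"
  shows "chain_vertex A (chain_degen A i s) k = chain_vertex A s (if k \<le> i then k else k - 1)"
proof (cases k)
  case 0
  then show ?thesis by (cases s) simp
next
  case (Suc l)
  with assms(3) have l: "l \<le> n" by simp
  have "chain_vertex A (chain_degen A i s) k = Trg A (snd (chain_degen A i s) ! l)"
    by (simp add: Suc Trg_chain)
  also have "\<dots> = chain_vertex A s (if k \<le> i then k else k - 1)"
    unfolding nth_chain_degen[OF length_chain[OF assms(1)] assms(2) l]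
    using assms l Suc by (cases l; cases i) (auto simp: Trg_chain chain_vertex_in le_Suc_eq)
  finally show ?thesis .
qed

lemma chain_face_in:
  assumes "s \<in> composable_chains A (Suc n)" "i \<le> Suc n"
  shows "chain_face A i s \<in> composable_chains A n"
proof (rule composable_chainsI)
  show "fst (chain_face A i s) \<in> Obj A"
    unfolding fst_eq_chain_vertex[of _ A]
    using assms by (auto simp: chain_vertex_face chain_vertex_in)
  show "length (snd (chain_face A i s)) = n"
    using length_chain[OF assms(1)] by (simp add: length_chain_face)
  fix k assume k: "k < n"
  show "snd (chain_face A i s) ! k \<in> Arr A"
    using assms k by (simp add: nth_chain_face[OF length_chain] Arr_chain Src_chain Trg_chain)
  show "Src A (snd (chain_face A i s) ! k) = chain_vertex A (chain_face A i s) k"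
    using assms k
    by (simp add: nth_chain_face[OF length_chain] Arr_chain Src_chain Trg_chain chain_vertex_face)
qed

lemma chain_degen_in:
  assumes "s \<in> composable_chains A n" "i \<le> n"
  shows "chain_degen A i s \<in> composable_chains A (Suc n)"
proof (rule composable_chainsI)
  show "fst (chain_degen A i s) \<in> Obj A"
    unfolding fst_eq_chain_vertex[of _ A]
    using assms by (auto simp: chain_vertex_degen chain_vertex_in)
  show "length (snd (chain_degen A i s)) = Suc n"
    using length_chain[OF assms(1)] assms(2) by (simp add: length_chain_degen)
  fix k assume "k < Suc n"
  then have k: "k \<le> n" by simp
  show "snd (chain_degen A i s) ! k \<in> Arr A"
    using assms k by (auto simp: nth_chain_degen[OF length_chain] Arr_chain chain_vertex_in)
  show "Src A (snd (chain_degen A i s) ! k) = chain_vertex A (chain_degen A i s) k"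
    using assms k
    by (auto simp: nth_chain_degen[OF length_chain] Src_chain chain_vertex_in chain_vertex_degen)
qed

theorem simplicial_set_nerve: "simplicial_set (nerve A)"
proof -
  note simps = nth_chain_face[OF length_chain] nth_chain_degen[OF length_chain]
    chain_vertex_face chain_vertex_degen
  have idR: "Cmp A (snd s ! k) (Idn A (chain_vertex A s k)) = snd s ! k"
    if "s \<in> composable_chains A n" "k < n" for s n k
    using that Cmp_Idn_right[of "snd s ! k"] by (simp add: Arr_chain Src_chain)
  have idL: "Cmp A (Idn A (chain_vertex A s (Suc k))) (snd s ! k) = snd s ! k"
    if "s \<in> composable_chains A n" "k < n" for s n k
    using that Cmp_Idn_left[of "snd s ! k"] by (simp add: Arr_chain Trg_chain)
  show ?thesis
    unfolding simplicial_set_def nerve_def sset.simps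
  proof (intro conjI allI impI, goal_cases)
    case (1 s n i)
    then show ?case by (simp add: chain_face_in)
  next
    case (2 s n i)
    then show ?case by (simp add: chain_degen_in)
  next
    case (3 s n i j)
    then have mem: "s \<in> composable_chains A (Suc (Suc n))"
      "chain_face A i s \<in> composable_chains A (Suc n)"
      "chain_face A j s \<in> composable_chains A (Suc n)"
      by (auto intro: chain_face_in)
    show ?case
    proof (rule chain_eqI[of _ A n])
      show "chain_face A i (chain_face A j s) \<in> composable_chains A n"
        "chain_face A (j - 1) (chain_face A i s) \<in> composable_chains A n"
        using 3(2,3) mem by (auto intro!: chain_face_in)
    qed (use 3(2,3) mem in \<open>auto simp: simps Arr_chain Src_chain Trg_chain Cmp_assoc\<close>)
  next
    case (4 s n i j)
    then obtain m where m: "n = Suc m" by (cases n) auto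
    with 4 have mem: "s \<in> composable_chains A (Suc m)"
      "chain_face A i s \<in> composable_chains A m"
      "chain_degen A j s \<in> composable_chains A (Suc (Suc m))"
      by (auto intro: chain_face_in chain_degen_in)
    show ?case
    proof (rule chain_eqI[of _ A "Suc m"])
      show "chain_face A i (chain_degen A j s) \<in> composable_chains A (Suc m)"
        "chain_degen A (j - 1) (chain_face A i s) \<in> composable_chains A (Suc m)"
        using 4(2,3) m mem by (auto intro!: chain_face_in chain_degen_in)
    qed (use 4(2,3) m mem in \<open>auto simp: simps\<close>)
  next
    case (5 s n j)
    then have mem: "s \<in> composable_chains A n"
      "chain_degen A j s \<in> composable_chains A (Suc n)"
      by (auto intro: chain_degen_in)
    show ?case
    proof (rule chain_eqI[of _ A n])
      show "chain_face A j (chain_degen A j s) \<in> composable_chains A n"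
        using 5(2) mem by (auto intro!: chain_face_in)
    qed (use 5(2) mem in \<open>auto simp: simps idL idR\<close>)
  next
    case (6 s n j)
    then have mem: "s \<in> composable_chains A n"
      "chain_degen A j s \<in> composable_chains A (Suc n)"
      by (auto intro: chain_degen_in)
    show ?case
    proof (rule chain_eqI[of _ A n])
      show "chain_face A (Suc j) (chain_degen A j s) \<in> composable_chains A n"
        using 6(2) mem by (auto intro!: chain_face_in)
    qed (use 6(2) mem in \<open>auto simp: simps idL idR\<close>)
  next
    case (7 s n j i)
    then obtain m where m: "n = Suc m" by (cases n) auto
    with 7 have mem: "s \<in> composable_chains A (Suc m)"
      "chain_face A (i - 1) s \<in> composable_chains A m"
      "chain_degen A j s \<in> composable_chains A (Suc (Suc m))"
      by (auto intro: chain_face_in chain_degen_in)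
    show ?case
    proof (rule chain_eqI[of _ A "Suc m"])
      show "chain_face A i (chain_degen A j s) \<in> composable_chains A (Suc m)"
        "chain_degen A j (chain_face A (i - 1) s) \<in> composable_chains A (Suc m)"
        using 7(2,3) m mem by (auto intro!: chain_face_in chain_degen_in)
    qed (use 7(2,3) m mem in \<open>auto simp: simps\<close>)
  next
    case (8 s n i j)
    then have mem: "s \<in> composable_chains A n"
      "chain_degen A i s \<in> composable_chains A (Suc n)"
      "chain_degen A j s \<in> composable_chains A (Suc n)"
      by (auto intro: chain_degen_in)
    show ?case
    proof (rule chain_eqI[of _ A "Suc (Suc n)"])
      show "chain_degen A i (chain_degen A j s) \<in> composable_chains A (Suc (Suc n))"
        "chain_degen A (Suc j) (chain_degen A i s) \<in> composable_chains A (Suc (Suc n))"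
        using 8(2,3) mem by (auto intro!: chain_degen_in)
    qed (use 8(2,3) mem in \<open>auto simp: simps\<close>)
  qed
qed

theorem degenerate_nerve_iff:
  assumes "(x, fs) \<in> Simp (nerve A) n"
  shows "degenerate (nerve A) n (x, fs) \<longleftrightarrow> (\<exists>f \<in> set fs. \<exists>a \<in> Obj A. f = Idn A a)"
proof
  assume "degenerate (nerve A) n (x, fs)"
  then obtain m i y gs where *: "(y, gs) \<in> composable_chains A m" "i \<le> m"
      "(x, fs) = chain_degen A i (y, gs)"
    by (auto simp: degenerate_def nerve_def)
  then show "\<exists>f \<in> set fs. \<exists>a \<in> Obj A. f = Idn A a"
    using chain_vertex_in[OF *(1,2)] by auto
next
  assume "\<exists>f \<in> set fs. \<exists>a \<in> Obj A. f = Idn A a"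
  then obtain i a where i: "i < length fs" "fs ! i = Idn A a" "a \<in> Obj A"
    by (metis in_set_conv_nth)
  define s where "s = (x, fs)"
  have s: "s \<in> composable_chains A n"
    using assms by (simp add: nerve_def s_def)
  then have len: "length fs = n"
    using length_chain[of s A n] by (simp add: s_def)
  with i obtain m where m: "n = Suc m" "i \<le> m"
    by (cases n) auto
  then have a: "a = chain_vertex A s i"
    using Src_chain[OF s, of i] i by (simp add: s_def)
  have TS: "chain_vertex A s (Suc i) = chain_vertex A s i"
    using i a by (simp add: s_def)
  define t where "t = chain_face A i s"
  have t: "t \<in> composable_chains A m"
    using s m by (auto simp: t_def intro!: chain_face_in)
  note simps = nth_chain_face[OF length_chain] nth_chain_degen[OF length_chain]
    chain_vertex_face chain_vertex_degen
  have "s = chain_degen A i t"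
  proof (rule chain_eqI[of _ A "Suc m"])
    show "s \<in> composable_chains A (Suc m)" "chain_degen A i t \<in> composable_chains A (Suc m)"
      using s t m by (auto intro!: chain_degen_in)
    show "chain_vertex A s 0 = chain_vertex A (chain_degen A i t) 0"
      using s t m TS by (cases i) (auto simp: t_def simps)
  next
    fix k assume k: "k < Suc m"
    have "Cmp A (fs ! i) (fs ! k) = fs ! k" if "Suc k = i"
      using Cmp_Idn_left[of "fs ! k"] Arr_chain[OF s, of k] i a m by (simp add: s_def flip: that)
    then show "snd s ! k = snd (chain_degen A i t) ! k"
      using s t m k i TS a
      by (cases "Suc k = i"; cases "k < i") (auto simp: t_def simps s_def simp del: chain_face.simps)
  qed
  then show "degenerate (nerve A) n (x, fs)"
    using t m unfolding degenerate_def nerve_def s_def sset.simps by blast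
qed

end

lemma (in finite_category) finite_nondegenerate_simplices:
  "finite (nondegenerate_simplices (nerve A) n)"
proof (rule finite_subset)
  show "nondegenerate_simplices (nerve A) n \<subseteq> Obj A \<times> {fs. set fs \<subseteq> Arr A \<and> length fs = n}"
    by (auto simp: nondegenerate_simplices_def nerve_def composable_chains_def)
qed (simp add: finite_Obj finite_Arr finite_lists_length_eq)


section \<open>Rational power series\<close>

text \<open>The canonical inclusion \<open>K(t) \<hookrightarrow> K((t))\<close>. The fraction is represented by an arbitrary pair
  with nonzero denominator; by \<open>fls_of_fract_Fract\<close> the choice does not matter.\<close>

definition fls_of_fract :: "'a::field poly fract \<Rightarrow> 'a fls" where
  "fls_of_fract r = (case rep_fract r of (p, q) \<Rightarrow>
     fps_to_fls (fps_of_poly p) / fps_to_fls (fps_of_poly q))"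

lemma fps_of_poly_eq_0_iff: "fps_of_poly p = 0 \<longleftrightarrow> p = 0"
  using fps_of_poly_eq_iff[of p 0] by simp

lemma fls_of_fract_Fract:
  fixes p q :: "'a::field poly"
  assumes "q \<noteq> 0"
  shows "fls_of_fract (Fract p q) = fps_to_fls (fps_of_poly p) / fps_to_fls (fps_of_poly q)"
proof -
  obtain p' q' where rep: "rep_fract (Fract p q) = (p', q')"
    by fastforce
  have "fractrel (rep_fract (Fract p q)) (p, q)"
    using assms Quotient_rep_abs[OF Quotient_fract, of "(p, q)"]
    by (simp add: Fract.abs_eq)
  with rep have "q' \<noteq> 0" "p' * q = p * q'"
    by simp_all
  moreover from this(2) have "fps_of_poly p' * fps_of_poly q = fps_of_poly p * fps_of_poly q'"
    by (simp flip: fps_of_poly_mult)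
  ultimately show ?thesis
    using assms by (simp add: fls_of_fract_def rep fps_of_poly_eq_0_iff frac_eq_eq flip: fls_times_fps_to_fls)
qed

lemma fls_of_fract_hom:
  fixes r s :: "'a::field poly fract"
  shows "fls_of_fract (r + s) = fls_of_fract r + fls_of_fract s"
    and "fls_of_fract (r * s) = fls_of_fract r * fls_of_fract s"
    and "fls_of_fract (Fract [:0, 1:] 1) = (fls_X :: 'a fls)"
    and "fls_of_fract (Fract [:c:] 1) = (fls_const c)"
    and "inj (fls_of_fract :: 'a poly fract \<Rightarrow> 'a fls)"
proof -
  show "fls_of_fract (r + s) = fls_of_fract r + fls_of_fract s"
    by (cases r; cases s)
      (simp add: fls_of_fract_Fract add_frac_eq fps_of_poly_eq_0_iff fps_of_poly_add fps_of_poly_mult fls_times_fps_to_fls)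
  show "fls_of_fract (r * s) = fls_of_fract r * fls_of_fract s"
    by (cases r; cases s)
      (simp add: fls_of_fract_Fract fps_of_poly_mult fls_times_fps_to_fls)
  show "fls_of_fract (Fract [:0, 1:] 1) = (fls_X :: 'a fls)"
    by (simp add: fls_of_fract_Fract fps_of_poly_pCons)
  show "fls_of_fract (Fract [:c:] 1) = (fls_const c)"
    by (simp add: fls_of_fract_Fract fps_of_poly_const)
  show "inj (fls_of_fract :: 'a poly fract \<Rightarrow> 'a fls)"
  proof (rule injI)
    fix r s :: "'a poly fract"
    assume *: "fls_of_fract r = fls_of_fract s"
    obtain a b where r: "r = Fract a b" "b \<noteq> 0" by (cases r)
    obtain c d where s: "s = Fract c d" "d \<noteq> 0" by (cases s)
    from * have "fps_of_poly (a * d) = fps_of_poly (c * b)"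
      by (simp add: r s fls_of_fract_Fract frac_eq_eq fps_of_poly_eq_0_iff fps_of_poly_mult flip: fls_times_fps_to_fls)
    with r s show "r = s"
      by (simp add: eq_fract fps_of_poly_eq_iff)
  qed
qed

definition rational_fps :: "'a::field fps \<Rightarrow> bool" where
  "rational_fps f \<longleftrightarrow> fps_to_fls f \<in> range fls_of_fract"

definition nondegenerate_series :: "('o, 'm) cat \<Rightarrow> rat fps" where
  "nondegenerate_series A = Abs_fps (\<lambda>n. of_nat (card (nondegenerate_simplices (nerve A) n)))"

end

theory Submission
  imports Defs
begin

text \<open>Let \<open>f\<^sub>x\<close> be the generating series of the chains of non-identity arrows that start at the
  object \<open>x\<close>. Removing the first arrow gives \<open>f\<^sub>x = 1 + t \<Sum>\<^sub>y a\<^sub>x\<^sub>y f\<^sub>y\<close>, where \<open>a\<^sub>x\<^sub>y\<close> is the number of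
  non-identity arrows from \<open>x\<close> to \<open>y\<close>. Because of the factor \<open>t\<close>, Gaussian elimination in this
  system only ever divides by power series with constant term \<open>1\<close>, so its solutions are
  rational.\<close>

section \<open>Closure properties of rational power series\<close>

text \<open>Clearing the denominator turns membership in the image of \<open>fls_of_fract\<close>
  into an equation between power series, so the closure properties can be proved without Laurent
  series.\<close>

lemma rational_fps_iff:
  "rational_fps f \<longleftrightarrow> (\<exists>p q. q \<noteq> 0 \<and> f * fps_of_poly q = fps_of_poly p)"
proof
  assume "rational_fps f"
  then obtain r where r: "fps_to_fls f = fls_of_fract r"
    by (auto simp: rational_fps_def)
  obtain p q where pq: "r = Fract p q" "q \<noteq> 0" by (cases r)
  have "fps_to_fls (f * fps_of_poly q) = fps_to_fls (fps_of_poly p)"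
    using r pq by (simp add: fls_of_fract_Fract fps_of_poly_eq_0_iff fls_times_fps_to_fls)
  with pq show "\<exists>p q. q \<noteq> 0 \<and> f * fps_of_poly q = fps_of_poly p"
    by auto
next
  assume "\<exists>p q. q \<noteq> 0 \<and> f * fps_of_poly q = fps_of_poly p"
  then obtain p q where pq: "q \<noteq> 0" "f * fps_of_poly q = fps_of_poly p" by auto
  then have "fps_to_fls f = fls_of_fract (Fract p q)"
    by (simp add: fls_of_fract_Fract fps_of_poly_eq_0_iff fls_times_fps_to_fls flip: pq(2))
  then show "rational_fps f"
    by (simp add: rational_fps_def)
qed

lemma rational_fps_of_poly: "rational_fps (fps_of_poly p)"
  unfolding rational_fps_iff by (intro exI[of _ p] exI[of _ 1]) simp

lemma rational_fps_const: "rational_fps (fps_const c)"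
  using rational_fps_of_poly[of "[:c:]"] by (simp add: fps_of_poly_const)

lemma rational_fps_0: "rational_fps 0"
  using rational_fps_of_poly[of 0] by simp

lemma rational_fps_1: "rational_fps 1"
  using rational_fps_of_poly[of 1] by simp

lemma rational_fps_X: "rational_fps fps_X"
  using rational_fps_of_poly[of "[:0, 1:]"] by (simp add: fps_of_poly_pCons)

lemma rational_fps_add:
  assumes "rational_fps f" "rational_fps g"
  shows "rational_fps (f + g)"
proof -
  from assms obtain p q p' q' where "q \<noteq> 0" "q' \<noteq> 0"
    and f: "f * fps_of_poly q = fps_of_poly p" and g: "g * fps_of_poly q' = fps_of_poly p'"
    by (auto simp: rational_fps_iff)
  then have "q * q' \<noteq> 0" "(f + g) * fps_of_poly (q * q') = fps_of_poly (p * q' + p' * q)"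
    by (simp_all add: fps_of_poly_add fps_of_poly_mult algebra_simps flip: f g)
  then show ?thesis
    unfolding rational_fps_iff by blast
qed

lemma rational_fps_mult:
  assumes "rational_fps f" "rational_fps g"
  shows "rational_fps (f * g)"
proof -
  from assms obtain p q p' q' where "q \<noteq> 0" "q' \<noteq> 0"
    and f: "f * fps_of_poly q = fps_of_poly p" and g: "g * fps_of_poly q' = fps_of_poly p'"
    by (auto simp: rational_fps_iff)
  then have "q * q' \<noteq> 0" "(f * g) * fps_of_poly (q * q') = fps_of_poly (p * p')"
    by (simp_all add: fps_of_poly_mult algebra_simps flip: f g)
  then show ?thesis
    unfolding rational_fps_iff by blast
qed

lemma rational_fps_diff:
  assumes "rational_fps f" "rational_fps g"
  shows "rational_fps (f - g)"
  using rational_fps_add[OF assms(1) rational_fps_mult[OF rational_fps_const[of "-1"] assms(2)]]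
  by (simp flip: fps_const_neg)

lemma rational_fps_inverse:
  assumes "rational_fps f"
  shows "rational_fps (inverse f)"
proof (cases "f $ 0 = 0")
  \<comment> \<open>With constant term 0, \<open>inverse f\<close> is 0 by convention.\<close>
  case True
  then show ?thesis by (simp add: fps_inverse_eq_0 rational_fps_0)
next
  case False
  from assms obtain p q where pq: "q \<noteq> 0" "f * fps_of_poly q = fps_of_poly p"
    by (auto simp: rational_fps_iff)
  from False have "f \<noteq> 0" by auto
  \<comment> \<open>Power series over a field have no zero divisors; so \<open>p\<close> can become
    the denominator of \<open>inverse f\<close>.\<close>
  with pq have "p \<noteq> 0"
    by (metis fps_of_poly_eq_0_iff mult_eq_0_iff)
  moreover have "inverse f * fps_of_poly p = fps_of_poly q"
    using False by (simp add: inverse_mult_eq_1 mult.assoc[symmetric] flip: pq(2))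
  ultimately show ?thesis
    unfolding rational_fps_iff by blast
qed

lemma rational_fps_sum:
  assumes "\<And>i. i \<in> I \<Longrightarrow> rational_fps (f i)"
  shows "rational_fps (\<Sum>i\<in>I. f i)"
  using assms by (induction I rule: infinite_finite_induct)
    (auto intro: rational_fps_0 rational_fps_add)

text \<open>Induction on the set of unknowns: the equation of one index \<open>k\<close> is solved
  for \<open>f k\<close> and substituted into the others. Elimination changes the coefficients, so
  the induction generalises over \<open>a\<close> and \<open>b\<close>.\<close>

lemma rational_fps_linear_system:
  fixes f b :: "'i \<Rightarrow> 'a::field fps"
  assumes "finite I"
    and "\<And>i. i \<in> I \<Longrightarrow> rational_fps (b i)"
    and "\<And>i j. i \<in> I \<Longrightarrow> j \<in> I \<Longrightarrow> rational_fps (a i j)"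
    and "\<And>i. i \<in> I \<Longrightarrow> f i = b i + fps_X * (\<Sum>j\<in>I. a i j * f j)"
    and "i \<in> I"
  shows "rational_fps (f i)"
  using assms
proof (induction I arbitrary: a b i rule: finite_induct)
  case empty
  then show ?case by simp
next
  case (insert k I)
  note rat = rational_fps_add rational_fps_mult rational_fps_sum rational_fps_diff
    rational_fps_inverse rational_fps_1 rational_fps_X insert.prems(1,2)
  \<comment> \<open>Collecting the terms in \<open>f k\<close> of equation \<open>k\<close> on the
    left leaves the factor inverted here; its constant term is 1.\<close>
  define u where "u = inverse (1 - fps_X * a k k)"
  have u: "u * (1 - fps_X * a k k) = 1"
    unfolding u_def by (rule inverse_mult_eq_1) simp
  have rat_u: "rational_fps u"
    unfolding u_def by (intro rat) auto
  have "(1 - fps_X * a k k) * f k = b k + fps_X * (\<Sum>j\<in>I. a k j * f j)"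
    using insert.prems(3)[of k] insert.hyps by (simp add: algebra_simps)
  then have fk: "f k = u * (b k + fps_X * (\<Sum>j\<in>I. a k j * f j))"
    using u by (metis mult.assoc mult_1)
  \<comment> \<open>Coefficients after substituting \<open>fk\<close> into equation
    \<open>i\<close>. The sum in \<open>fk\<close> carries its own \<open>fps_X\<close>, so one
    factor \<open>fps_X\<close> remains in front of the new sum and the system keeps its
    shape.\<close>
  define b' where "b' i = b i + fps_X * a i k * u * b k" for i
  define a' where "a' i j = a i j + fps_X * a i k * u * a k j" for i j
  have rat_f: "rational_fps (f i)" if "i \<in> I" for i
  proof (rule insert.IH[of b' a'])
    show "rational_fps (b' i)" if "i \<in> I" for i
      unfolding b'_def using that rat_u by (intro rat) auto
    show "rational_fps (a' i j)" if "i \<in> I" "j \<in> I" for i j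
      unfolding a'_def using that rat_u by (intro rat) auto
    fix i assume "i \<in> I"
    then have "f i = b i + fps_X * (a i k * f k + (\<Sum>j\<in>I. a i j * f j))"
      using insert.prems(3)[of i] insert.hyps by simp
    also have "\<dots> = b' i + fps_X * (\<Sum>j\<in>I. a' i j * f j)"
      by (subst fk) (simp add: a'_def b'_def sum.distrib sum_distrib_left algebra_simps)
    finally show "f i = b' i + fps_X * (\<Sum>j\<in>I. a' i j * f j)" .
  qed (fact that)
  \<comment> \<open>Back substitution: \<open>fk\<close> expresses \<open>f k\<close> through series
    now known to be rational.\<close>
  moreover have "rational_fps (f k)"
    by (subst fk) (intro rat rat_u rat_f; simp)
  ultimately show ?case
    using insert.prems(4) by auto
qed


section \<open>Counting the nondegenerate simplices of a nerve\<close>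

definition nonidentity_arrows :: "('o, 'm) cat \<Rightarrow> 'm set" where
  "nonidentity_arrows A = Arr A - Idn A ` Obj A"

text \<open>The start object becomes a parameter, which allows recursion on the first arrow. The set
  is empty for \<open>x\<close> outside \<open>Obj A\<close>.\<close>

definition nondegenerate_from :: "('o, 'm) cat \<Rightarrow> nat \<Rightarrow> 'o \<Rightarrow> 'm list set" where
  "nondegenerate_from A n x = {fs. (x, fs) \<in> nondegenerate_simplices (nerve A) n}"

context category
begin

lemma nondegenerate_simplices_nerve:
  "(x, fs) \<in> nondegenerate_simplices (nerve A) n \<longleftrightarrow>
    (x, fs) \<in> composable_chains A n \<and> set fs \<subseteq> nonidentity_arrows A"
proof -
  have "(x, fs) \<in> composable_chains A n \<Longrightarrow> set fs \<subseteq> Arr A"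
    by (auto simp: composable_chains_def)
  then show ?thesis
    using degenerate_nerve_iff[of x fs n]
    by (auto simp: nondegenerate_simplices_def nonidentity_arrows_def nerve_def)
qed

lemma nondegenerate_simplices_Sigma:
  "nondegenerate_simplices (nerve A) n = Sigma (Obj A) (nondegenerate_from A n)"
  by (auto simp: nondegenerate_from_def nondegenerate_simplices_nerve composable_chains_def)

lemma Cons_in_composable_chains:
  "(x, h # fs) \<in> composable_chains A (Suc n) \<longleftrightarrow>
    h \<in> Arr A \<and> Src A h = x \<and> (Trg A h, fs) \<in> composable_chains A n"
proof -
  \<comment> \<open>Removing the first arrow shifts the vertices by one.
    \<open>All_less_Suc2\<close> then splits off the condition on the source of
    \<open>h\<close>.\<close>
  have "chain_vertex A (x, h # fs) (Suc k) = chain_vertex A (Trg A h, fs) k" for k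
    by (cases k) auto
  then show ?thesis
    by (auto simp: composable_chains_def All_less_Suc2 simp del: chain_vertex.simps(2))
qed

lemma nondegenerate_from_0: "x \<in> Obj A \<Longrightarrow> nondegenerate_from A 0 x = {[]}"
  by (auto simp: nondegenerate_from_def nondegenerate_simplices_nerve composable_chains_def)

text \<open>Composability and the absence of identities can both be checked separately on the first
  arrow and on the chain starting at its target.\<close>

lemma nondegenerate_from_Suc:
  "nondegenerate_from A (Suc n) x =
    (\<lambda>(h, fs). h # fs) `
      Sigma {h \<in> nonidentity_arrows A. Src A h = x} (\<lambda>h. nondegenerate_from A n (Trg A h))"
proof (rule set_eqI)
  fix gs
  show "gs \<in> nondegenerate_from A (Suc n) x \<longleftrightarrow> gs \<in> (\<lambda>(h, fs). h # fs) `
      Sigma {h \<in> nonidentity_arrows A. Src A h = x} (\<lambda>h. nondegenerate_from A n (Trg A h))"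
  proof (cases gs)
    case Nil
    then show ?thesis
      by (auto simp: nondegenerate_from_def nondegenerate_simplices_nerve composable_chains_def)
  next
    case (Cons h fs)
    then show ?thesis
      by (auto simp: nondegenerate_from_def nondegenerate_simplices_nerve
          Cons_in_composable_chains nonidentity_arrows_def)
  qed
qed

end

context finite_category
begin

lemma finite_nonidentity_arrows: "finite (nonidentity_arrows A)"
  by (simp add: nonidentity_arrows_def finite_Arr)

lemma finite_nondegenerate_from: "finite (nondegenerate_from A n x)"
proof (rule finite_subset)
  show "nondegenerate_from A n x \<subseteq> snd ` nondegenerate_simplices (nerve A) n"
    by (force simp: nondegenerate_from_def)
qed (simp add: finite_nondegenerate_simplices)

lemma card_nondegenerate_simplices:
  "card (nondegenerate_simplices (nerve A) n) = (\<Sum>x\<in>Obj A. card (nondegenerate_from A n x))"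
  by (simp add: nondegenerate_simplices_Sigma finite_Obj finite_nondegenerate_from card_SigmaI)

lemma card_nondegenerate_from_Suc:
  "card (nondegenerate_from A (Suc n) x) =
    (\<Sum>y\<in>Obj A. card {h \<in> nonidentity_arrows A. Src A h = x \<and> Trg A h = y}
      * card (nondegenerate_from A n y))"
proof -
  let ?H = "{h \<in> nonidentity_arrows A. Src A h = x}"
  have H: "finite ?H" "Trg A ` ?H \<subseteq> Obj A"
    by (simp add: finite_nonidentity_arrows) (auto simp: nonidentity_arrows_def)
  have "card (nondegenerate_from A (Suc n) x) =
      card (Sigma ?H (\<lambda>h. nondegenerate_from A n (Trg A h)))"
    unfolding nondegenerate_from_Suc by (rule card_image) (auto simp: inj_on_def)
  also have "\<dots> = (\<Sum>h\<in>?H. card (nondegenerate_from A n (Trg A h)))"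
    using H by (simp add: finite_nondegenerate_from card_SigmaI)
  \<comment> \<open>Grouping the first arrows by target makes the summand constant on each
    group.\<close>
  also have "\<dots> = (\<Sum>y\<in>Obj A. \<Sum>h\<in>{h \<in> ?H. Trg A h = y}. card (nondegenerate_from A n (Trg A h)))"
    by (rule sum.group[symmetric]) (use H finite_Obj in auto)
  also have "\<dots> = (\<Sum>y\<in>Obj A. card {h \<in> nonidentity_arrows A. Src A h = x \<and> Trg A h = y}
      * card (nondegenerate_from A n y))"
    by (simp add: conj_ac)
  finally show ?thesis .
qed

end

theorem theorem2p2:
  fixes A :: "('o, 'm) cat"
  assumes "finite_category A"
  shows "rational_fps (nondegenerate_series A)"
proof -
  interpret finite_category A by fact
  define f :: "'o \<Rightarrow> rat fps"
    where "f x = Abs_fps (\<lambda>n. of_nat (card (nondegenerate_from A n x)))" for x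
  define a :: "'o \<Rightarrow> 'o \<Rightarrow> rat fps" where
    "a x y = fps_const (of_nat (card {h \<in> nonidentity_arrows A. Src A h = x \<and> Trg A h = y}))" for x y
  have "f x = 1 + fps_X * (\<Sum>y\<in>Obj A. a x y * f y)" if "x \<in> Obj A" for x
  proof (rule fps_ext)
    fix n
    \<comment> \<open>The constant term 1 counts the empty chain; \<open>fps_X\<close> shifts the
      index, so the other coefficients are the recursion on the first arrow.\<close>
    show "f x $ n = (1 + fps_X * (\<Sum>y\<in>Obj A. a x y * f y)) $ n"
      using that by (cases n)
        (simp_all add: f_def a_def nondegenerate_from_0 card_nondegenerate_from_Suc fps_sum_nth)
  qed
  then have "rational_fps (f x)" if "x \<in> Obj A" for x
    using rational_fps_linear_system[of "Obj A" "\<lambda>_. 1" a f x] that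
    by (simp add: finite_Obj rational_fps_1 a_def rational_fps_const)
  moreover have "nondegenerate_series A = (\<Sum>x\<in>Obj A. f x)"
    by (rule fps_ext)
      (simp add: nondegenerate_series_def f_def fps_sum_nth card_nondegenerate_simplices)
  ultimately show ?thesis
    by (simp add: rational_fps_sum)
qed

end
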